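(* Let $G$ be a graph, let $S\subseteq V(G)$ be any subset of vertices, and let $\mathcal{F}$ be any finite family of $S$-stable separations of $G$. Define $$X:=S\cup\bigcup_{(A,B)\in\mathcal{F}} (A\cap B).$$ Suppose that $Z$ is the vertex set of any connected component of $G\setminus X$. Then $|N(Z)|\leq |S|$.
   Context: Graphs are finite, simple and undirected. $N(Z)$ is the set of vertices outside $Z$ having a neighbour in $Z$. A separation of $G$ is a pair $(A,B)$ with $A\cup B=V(G)$ and no edge between $A\setminus B$ and $B\setminus A$; its order is $|A\cap B|$. For (not necessarily disjoint) $P,Q\subseteq V(G)$, a $P-Q$ separation is a separation $(A,B)$ with $P\subseteq A$ and $Q\subseteq B$. A separation $(A,B)$ is $S$-stable if there is a partition $(S_L,S_R)$ of $S$ (disjoint, possibly empty parts with union $S$) such that $(A,B)$ has minimum order among all $S_L-S_R$ separations of $G$. *)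

theory Defs
  imports "Graph_Theory.Digraph_Component"
begin

text \<open>
  A finite simple undirected graph is an instance of the locale \<^locale>\<open>graph\<close>: a finite,
  loop-free, symmetric digraph without parallel arcs. An undirected edge is a pair of
  opposite arcs.
\<close>

definition components :: "('a, 'b) pre_digraph \<Rightarrow> ('a, 'b) pre_digraph set" where
  "components G = {C. pre_digraph.max_subgraph G Digraph_Component.connected C}"

definition del_verts :: "('a, 'b) pre_digraph \<Rightarrow> 'a set \<Rightarrow> ('a, 'b) pre_digraph" where
  "del_verts G X = G \<restriction> (verts G - X)"

definition neighbourhood :: "('a, 'b) pre_digraph \<Rightarrow> 'a set \<Rightarrow> 'a set" where
  "neighbourhood G Z = {v \<in> verts G - Z. \<exists>u\<in>Z. u \<rightarrow>\<^bsub>G\<^esub> v}"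

text \<open>Arcs come in opposite pairs, so excluding one direction excludes the edge.\<close>

definition separation :: "('a, 'b) pre_digraph \<Rightarrow> 'a set \<times> 'a set \<Rightarrow> bool" where
  "separation G = (\<lambda>(A, B). A \<union> B = verts G \<and> (\<forall>u \<in> A - B. \<forall>v \<in> B - A. \<not> u \<rightarrow>\<^bsub>G\<^esub> v))"

definition sep_order :: "'a set \<times> 'a set \<Rightarrow> nat" where
  "sep_order = (\<lambda>(A, B). card (A \<inter> B))"

definition separation_between ::
    "('a, 'b) pre_digraph \<Rightarrow> 'a set \<Rightarrow> 'a set \<Rightarrow> 'a set \<times> 'a set \<Rightarrow> bool" where
  "separation_between G P Q = (\<lambda>(A, B). separation G (A, B) \<and> P \<subseteq> A \<and> Q \<subseteq> B)"

definition stable_separation ::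
    "('a, 'b) pre_digraph \<Rightarrow> 'a set \<Rightarrow> 'a set \<times> 'a set \<Rightarrow> bool" where
  "stable_separation G S s \<longleftrightarrow>
    (\<exists>SL SR. SL \<union> SR = S \<and> SL \<inter> SR = {} \<and>
      is_arg_min sep_order (separation_between G SL SR) s)"

end

theory Submission
  imports Defs
begin

text \<open>
  Start from the separation \<open>(S, V)\<close> of order \<open>|S|\<close>, whose right side strictly contains \<open>Z\<close>, and
  uncross it with the members of \<open>\<F>\<close> one at a time. Since \<open>Z\<close> is connected and avoids \<open>A \<inter> B\<close>, it
  lies strictly on one side of \<open>(A, B) \<in> \<F>\<close>, say in \<open>B - A\<close>. Replacing the current separation
  \<open>(C, D)\<close> by \<open>(A \<union> C, B \<inter> D)\<close> does not increase the order: by submodularity an increase would make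
  the order of \<open>(A \<inter> C, B \<union> D)\<close> smaller than that of \<open>(A, B)\<close>, contradicting stability. In the end
  \<open>X \<subseteq> C\<close> and \<open>Z \<subseteq> D - C\<close>, hence \<open>N(Z) \<subseteq> C \<inter> D\<close>.
\<close>

section \<open>Connectedness and components\<close>

lemma dominates_del_verts:
  "u \<rightarrow>\<^bsub>del_verts G X\<^esub> v \<longleftrightarrow> u \<rightarrow>\<^bsub>G\<^esub> v \<and> u \<in> verts G - X \<and> v \<in> verts G - X"
  by (auto simp: del_verts_def arcs_ends_conv)

lemma dominates_mk_symmetric:
  "(u, v) \<in> parcs (mk_symmetric H) \<longleftrightarrow> u \<rightarrow>\<^bsub>H\<^esub> v \<or> v \<rightarrow>\<^bsub>H\<^esub> u"
  by (auto simp: mk_symmetric_def arcs_ends_conv)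

text \<open>Connectedness means strong connectedness of the symmetric closure, whose walks may
  follow arcs of \<open>H\<close> backwards. This is why membership in \<open>P\<close> has to pass
  along arcs in both directions; induction along a walk from \<open>u\<close> then covers
  \<open>H\<close>.\<close>

lemma connected_closed_subset:
  assumes "connected H" "u \<in> verts H" "u \<in> P"
    and "\<And>x y. x \<rightarrow>\<^bsub>H\<^esub> y \<Longrightarrow> x \<in> P \<longleftrightarrow> y \<in> P"
  shows "verts H \<subseteq> P"
proof
  fix v assume "v \<in> verts H"
  then have "u \<rightarrow>\<^sup>*\<^bsub>with_proj (mk_symmetric H)\<^esub> v"
    using assms(1,2) by (auto simp: connected_def strongly_connected_def mk_symmetric_def)
  then show "v \<in> P"
    unfolding reachable_def
    by (induction rule: rtrancl_on_induct) (use assms(3,4) in \<open>auto simp: dominates_mk_symmetric\<close>)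
qed

lemma subgraph_dominates:
  assumes "subgraph H K" "u \<rightarrow>\<^bsub>H\<^esub> v"
  shows "u \<rightarrow>\<^bsub>K\<^esub> v"
  using assms by (auto simp: subgraph_def compatible_def arcs_ends_conv)

text \<open>Follows from maximality: otherwise \<open>v\<close> could be joined to \<open>H\<close>
  without losing connectedness. Applied to \<open>del_verts G X\<close>, it forces the neighbours of
  \<open>Z\<close> into \<open>X\<close>.\<close>

lemma component_closed:
  assumes wf: "wf_digraph K" and C: "H \<in> components K"
    and u: "u \<in> verts H" and uv: "u \<rightarrow>\<^bsub>K\<^esub> v"
  shows "v \<in> verts H"
proof (rule ccontr)
  assume v: "v \<notin> verts H"
  interpret wf_digraph K by fact
  have sub: "subgraph H K" and con: "connected H"
    and max: "\<And>H'. H' \<noteq> H \<Longrightarrow> subgraph H H' \<Longrightarrow> subgraph H' K \<Longrightarrow> \<not> connected H'"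
    using C by (auto simp: components_def max_subgraph_def)
  \<comment> \<open>Taking the induced subgraph keeps all arcs of \<open>H\<close> and adds the arc
    from \<open>u\<close> to \<open>v\<close>.\<close>
  define H' where "H' = K \<restriction> insert v (verts H)"
  let ?M = "with_proj (mk_symmetric H')"
  have vK: "insert v (verts H) \<subseteq> verts K"
    using sub uv adj_in_verts by (auto simp: subgraph_def)
  then have H'K: "subgraph H' K"
    unfolding H'_def by (intro induced_imp_subgraph induced_induce)
  have HH': "subgraph H H'"
    using sub H'K unfolding H'_def
    by (auto simp: subgraph_def compatible_def induce_subgraph_def wf_digraph_def)
  have sym: "symmetric ?M"
    by (auto simp: symmetric_def dominates_mk_symmetric intro!: symI)
  have wfM: "wf_digraph ?M"
    using H'K by (auto simp: subgraph_def wf_digraph_def mk_symmetric_def)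
  \<comment> \<open>The vertices that \<open>u\<close> reaches in \<open>?M\<close> are closed under
    arcs of \<open>H\<close>, which occur in \<open>?M\<close> in both directions; so they include
    all of \<open>H\<close>.\<close>
  have "verts H \<subseteq> {x. u \<rightarrow>\<^sup>*\<^bsub>?M\<^esub> x}"
  proof (rule connected_closed_subset[OF con u])
    show "u \<in> {x. u \<rightarrow>\<^sup>*\<^bsub>?M\<^esub> x}"
      using u by (auto simp: reachable_def mk_symmetric_def H'_def)
  next
    fix x y assume "x \<rightarrow>\<^bsub>H\<^esub> y"
    then have "x \<rightarrow>\<^bsub>?M\<^esub> y" "y \<rightarrow>\<^bsub>?M\<^esub> x"
      using subgraph_dominates[OF HH'] by (auto simp: dominates_mk_symmetric)
    then show "x \<in> {x. u \<rightarrow>\<^sup>*\<^bsub>?M\<^esub> x} \<longleftrightarrow> y \<in> {x. u \<rightarrow>\<^sup>*\<^bsub>?M\<^esub> x}"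
      using wf_digraph.reachable_adj_trans[OF wfM] by blast
  qed
  moreover have "u \<rightarrow>\<^bsub>?M\<^esub> v"
    using uv u by (auto simp: dominates_mk_symmetric H'_def arcs_ends_conv)
  ultimately have reach: "u \<rightarrow>\<^sup>*\<^bsub>?M\<^esub> x" if "x \<in> insert v (verts H)" for x
    using that u wf_digraph.reachable_adj_trans[OF wfM] by blast
  have "connected H'"
    unfolding connected_def
  proof (rule strongly_connectedI)
    show "verts ?M \<noteq> {}" by (simp add: mk_symmetric_def H'_def)
  next
    fix x y assume "x \<in> verts ?M" "y \<in> verts ?M"
    then have "u \<rightarrow>\<^sup>*\<^bsub>?M\<^esub> x" "u \<rightarrow>\<^sup>*\<^bsub>?M\<^esub> y"
      using reach by (auto simp: mk_symmetric_def H'_def)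
    then show "x \<rightarrow>\<^sup>*\<^bsub>?M\<^esub> y"
      using symmetric_reachable[OF sym] wf_digraph.reachable_trans[OF wfM] by blast
  qed
  moreover have "verts H' \<noteq> verts H" using v unfolding H'_def by auto
  ultimately show False using max[OF _ HH' H'K] by blast
qed

section \<open>Separations, their corners and submodularity\<close>

lemma separation_swap:
  assumes "symmetric G" "separation G (A, B)"
  shows "separation G (B, A)"
  using assms(2) arcs_ends_symmetric[OF assms(1)] unfolding separation_def by blast

text \<open>An edge crossing a corner would already cross \<open>(A, B)\<close> or
  \<open>(C, D)\<close>.\<close>

lemma separation_corner:
  assumes "separation G (A, B)" "separation G (C, D)"
  shows "separation G (A \<inter> C, B \<union> D)" "separation G (A \<union> C, B \<inter> D)"
  using assms unfolding separation_def prod.case by blast+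

text \<open>The separators of two opposite corners have the same union and the same intersection as
  \<open>A \<inter> B\<close> and \<open>C \<inter> D\<close>, so inclusion-exclusion gives even
  equality. The common ground set is what makes these set identities hold.\<close>

lemma sep_order_submodular:
  assumes "finite (A \<union> B)" "finite (C \<union> D)" "A \<union> B = C \<union> D"
  shows "sep_order (A \<inter> C, B \<union> D) + sep_order (A \<union> C, B \<inter> D) = sep_order (A, B) + sep_order (C, D)"
proof -
  have "A \<inter> C \<inter> (B \<union> D) \<union> (A \<union> C) \<inter> (B \<inter> D) = A \<inter> B \<union> C \<inter> D"
       "A \<inter> C \<inter> (B \<union> D) \<inter> ((A \<union> C) \<inter> (B \<inter> D)) = A \<inter> B \<inter> (C \<inter> D)"
    using assms(3) by blast+
  then show ?thesis
    using card_Un_Int[of "A \<inter> C \<inter> (B \<union> D)" "(A \<union> C) \<inter> (B \<inter> D)"]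
      card_Un_Int[of "A \<inter> B" "C \<inter> D"] assms(1,2)
    by (simp add: sep_order_def)
qed

text \<open>The corner \<open>(A \<inter> C, B \<union> D)\<close> is again a separation between
  \<open>P\<close> and \<open>Q\<close>, so its order is at least that of \<open>(A, B)\<close>; the
  order of the opposite corner has to compensate.\<close>

lemma sep_order_uncross:
  assumes "finite (verts G)"
    and min: "is_arg_min sep_order (separation_between G P Q) (A, B)"
    and CD: "separation G (C, D)" "P \<subseteq> C"
  shows "sep_order (A \<union> C, B \<inter> D) \<le> sep_order (C, D)"
proof -
  have AB: "separation G (A, B)" "P \<subseteq> A" "Q \<subseteq> B"
    using min by (auto simp: is_arg_min_def separation_between_def)
  then have "separation_between G P Q (A \<inter> C, B \<union> D)"
    using separation_corner(1)[OF AB(1) CD(1)] CD(2) by (auto simp: separation_between_def)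
  then have "sep_order (A, B) \<le> sep_order (A \<inter> C, B \<union> D)"
    using min by (auto simp: is_arg_min_def not_less)
  moreover have "A \<union> B = verts G" "C \<union> D = verts G"
    using AB(1) CD(1) by (auto simp: separation_def)
  ultimately show ?thesis
    using sep_order_submodular[of A B C D] assms(1) by simp
qed

section \<open>Uncrossing along the family\<close>

text \<open>Exchanging \<open>SL\<close> and \<open>SR\<close> witnesses stability of the reversed
  pair. This allows \<open>Z\<close> to be placed on the right side of every member of the
  family.\<close>

lemma stable_separation_swap:
  assumes "symmetric G" "stable_separation G S (A, B)"
  shows "stable_separation G S (B, A)"
proof -
  obtain SL SR where S: "SL \<union> SR = S" "SL \<inter> SR = {}"
    and min: "is_arg_min sep_order (separation_between G SL SR) (A, B)"
    using assms(2) by (auto simp: stable_separation_def)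
  have sep: "separation_between G SR SL (D, C) \<longleftrightarrow> separation_between G SL SR (C, D)" for C D
    using separation_swap[OF assms(1)] by (auto simp: separation_between_def)
  have order: "sep_order (D, C) = sep_order (C, D)" for C D :: "'a set"
    by (simp add: sep_order_def Int_commute)
  have "is_arg_min sep_order (separation_between G SR SL) (B, A)"
    unfolding is_arg_min_def
  proof (intro conjI notI; (elim exE conjE)?)
    show "separation_between G SR SL (B, A)"
      using min sep by (simp add: is_arg_min_def)
  next
    fix t assume t: "separation_between G SR SL t" "sep_order t < sep_order (B, A)"
    obtain D C where "t = (D, C)" by fastforce
    then have "separation_between G SL SR (C, D)" "sep_order (C, D) < sep_order (A, B)"
      using t sep order[of D C] order[of B A] by auto
    then show False using min unfolding is_arg_min_def by blast
  qed
  then show ?thesis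
    using S unfolding stable_separation_def by blast
qed

text \<open>Uncrossing applies with \<open>P = SL\<close>, because \<open>C\<close> contains all of
  \<open>S\<close> whichever partition witnesses stability. Hence one and the same
  \<open>(C, D)\<close> can be uncrossed with members having different partitions.\<close>

lemma stable_separation_step:
  assumes "finite (verts G)" "stable_separation G S (A, B)" "Z \<subseteq> B - A"
    and "separation G (C, D)" "S \<subseteq> C" "Z \<subseteq> D - C"
  shows "separation G (A \<union> C, B \<inter> D)" "Z \<subseteq> (B \<inter> D) - (A \<union> C)"
    "sep_order (A \<union> C, B \<inter> D) \<le> sep_order (C, D)"
proof -
  obtain SL SR where S: "SL \<union> SR = S"
    and min: "is_arg_min sep_order (separation_between G SL SR) (A, B)"
    using assms(2) by (auto simp: stable_separation_def)
  have "separation G (A, B)"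
    using min by (auto simp: is_arg_min_def separation_between_def)
  then show "separation G (A \<union> C, B \<inter> D)"
    using separation_corner(2) assms(4) by blast
  show "Z \<subseteq> (B \<inter> D) - (A \<union> C)" using assms(3,6) by blast
  show "sep_order (A \<union> C, B \<inter> D) \<le> sep_order (C, D)"
    using sep_order_uncross[OF assms(1) min assms(4)] S assms(5) by blast
qed

text \<open>No arc of \<open>H\<close> can join \<open>A - B\<close> to its complement: both ends
  avoid \<open>A \<inter> B\<close>, so the arc would cross the separation.\<close>

lemma connected_separation_side:
  assumes "symmetric G" "separation G (A, B)"
    and H: "connected H" "verts H \<subseteq> verts G - A \<inter> B"
    and wf: "wf_digraph H" and adj: "\<And>u v. u \<rightarrow>\<^bsub>H\<^esub> v \<Longrightarrow> u \<rightarrow>\<^bsub>G\<^esub> v"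
  shows "verts H \<subseteq> A - B \<or> verts H \<subseteq> B - A"
proof (cases "verts H \<inter> (A - B) = {}")
  case True
  then show ?thesis using H(2) assms(2) by (auto simp: separation_def)
next
  case False
  then obtain u where u: "u \<in> verts H" "u \<in> A - B" by blast
  have "x \<in> A - B \<longleftrightarrow> y \<in> A - B" if "x \<rightarrow>\<^bsub>H\<^esub> y" for x y
  proof -
    have "x \<rightarrow>\<^bsub>G\<^esub> y" "y \<rightarrow>\<^bsub>G\<^esub> x"
      using adj[OF that] arcs_ends_symmetric[OF assms(1)] by blast+
    moreover have "x \<in> verts G - A \<inter> B" "y \<in> verts G - A \<inter> B"
      using wf_digraph.adj_in_verts[OF wf that] H(2) by blast+
    ultimately show ?thesis
      using assms(2) unfolding separation_def by blast
  qed
  then show ?thesis using connected_closed_subset[OF H(1) u] by blast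
qed

lemma uncross_all:
  assumes "symmetric G" "finite (verts G)" "S \<subseteq> verts G" "finite F"
    and "\<And>s. s \<in> F \<Longrightarrow> stable_separation G S s"
    and "\<And>A B. (A, B) \<in> F \<Longrightarrow> Z \<subseteq> A - B \<or> Z \<subseteq> B - A"
    and "Z \<subseteq> verts G - S"
  obtains C D where "separation G (C, D)" "S \<union> (\<Union>(A, B)\<in>F. A \<inter> B) \<subseteq> C"
    "Z \<subseteq> D - C" "sep_order (C, D) \<le> card S"
proof -
  have "\<exists>C D. separation G (C, D) \<and> S \<union> (\<Union>(A, B)\<in>F. A \<inter> B) \<subseteq> C \<and>
      Z \<subseteq> D - C \<and> sep_order (C, D) \<le> card S"
    using assms(4-6)
  proof (induction F)
    case empty
    have "separation G (S, verts G)" "sep_order (S, verts G) = card S"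
      using assms(3) by (auto simp: separation_def sep_order_def Int_absorb2)
    then show ?case using assms(7) by (intro exI[of _ S] exI[of _ "verts G"]) auto
  next
    case (insert s F)
    obtain A B where s: "s = (A, B)" by fastforce
    have "\<exists>C D. separation G (C, D) \<and> S \<union> (\<Union>(A, B)\<in>F. A \<inter> B) \<subseteq> C \<and>
      Z \<subseteq> D - C \<and> sep_order (C, D) \<le> card S"
      by (rule insert.IH) (use insert.prems in auto)
    then obtain C D where CD: "separation G (C, D)" "S \<union> (\<Union>(A, B)\<in>F. A \<inter> B) \<subseteq> C"
      "Z \<subseteq> D - C" "sep_order (C, D) \<le> card S" by blast
    have st: "stable_separation G S (A, B)" "stable_separation G S (B, A)"
      using insert.prems(1) s stable_separation_swap[OF assms(1)] by auto
    \<comment> \<open>Orient the new member so that \<open>Z\<close> lies strictly on its right; the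
      separator stays the same.\<close>
    obtain A' B' where A': "A' \<inter> B' = A \<inter> B" "Z \<subseteq> B' - A'" "stable_separation G S (A', B')"
    proof -
      consider "Z \<subseteq> A - B" | "Z \<subseteq> B - A" using insert.prems(2) s by blast
      then show ?thesis using that[of A B] that[of B A] st by cases auto
    qed
    have "S \<subseteq> C" using CD(2) by blast
    note step = stable_separation_step[OF assms(2) A'(3,2) CD(1) this CD(3)]
    have "S \<union> (\<Union>(A, B)\<in>insert s F. A \<inter> B) \<subseteq> A' \<union> C"
      using CD(2) A'(1) s by auto
    then show ?case
      using step(1,2) le_trans[OF step(3) CD(4)]
      by (intro exI[of _ "A' \<union> C"] exI[of _ "B' \<inter> D"] conjI)
  qed
  then show ?thesis using that by blast
qed

theorem lemma3p2:
  fixes G :: "('a, 'b) pre_digraph"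
    and S X Z :: "'a set"
    and F :: "('a set \<times> 'a set) set"
  assumes "graph G"
    and "S \<subseteq> verts G"
    and "finite F"
    and "\<And>s. s \<in> F \<Longrightarrow> stable_separation G S s"
    and "X = S \<union> (\<Union>(A, B)\<in>F. A \<inter> B)"
    and "Z \<in> verts ` components (del_verts G X)"
  shows "card (neighbourhood G Z) \<le> card S"
proof -
  interpret graph G by fact
  obtain H where H: "H \<in> components (del_verts G X)" "Z = verts H"
    using assms(6) by blast
  have sub: "subgraph H (del_verts G X)" and con: "connected H"
    using H(1) by (auto simp: components_def pre_digraph.max_subgraph_def)
  have wf: "wf_digraph H" "wf_digraph (del_verts G X)"
    using sub by (auto simp: subgraph_def)
  have ZX: "Z \<subseteq> verts G - X"
    using sub H(2) by (auto simp: subgraph_def del_verts_def)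
  have adj: "u \<rightarrow>\<^bsub>G\<^esub> v" if "u \<rightarrow>\<^bsub>H\<^esub> v" for u v
    using subgraph_dominates[OF sub that] by (simp add: dominates_del_verts)
  have side: "Z \<subseteq> A - B \<or> Z \<subseteq> B - A" if "(A, B) \<in> F" for A B
  proof -
    have "separation G (A, B)"
      using assms(4)[OF that]
      by (auto simp: stable_separation_def is_arg_min_def separation_between_def)
    moreover have "verts H \<subseteq> verts G - A \<inter> B"
      using ZX H(2) assms(5) that by blast
    ultimately show ?thesis
      unfolding H(2) using connected_separation_side[OF sym_arcs _ con _ wf(1) adj] by blast
  qed
  have "Z \<subseteq> verts G - S" using ZX assms(5) by blast
  obtain C D where CD: "separation G (C, D)" "S \<union> (\<Union>(A, B)\<in>F. A \<inter> B) \<subseteq> C"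
    "Z \<subseteq> D - C" "sep_order (C, D) \<le> card S"
    by (rule uncross_all[OF sym_arcs finite_verts assms(2,3,4) side \<open>Z \<subseteq> verts G - S\<close>])
  have "neighbourhood G Z \<subseteq> C \<inter> D"
  proof
    fix v assume "v \<in> neighbourhood G Z"
    then obtain u where v: "v \<in> verts G" "v \<notin> Z" and u: "u \<in> Z" "u \<rightarrow>\<^bsub>G\<^esub> v"
      by (auto simp: neighbourhood_def)
    \<comment> \<open>Outside \<open>X\<close> the edge from \<open>u\<close> to \<open>v\<close>
      would survive the deletion and \<open>v\<close> would belong to the component.\<close>
    have "v \<in> X"
    proof (rule ccontr)
      assume "v \<notin> X"
      then have "u \<rightarrow>\<^bsub>del_verts G X\<^esub> v"
        using u v ZX by (auto simp: dominates_del_verts)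
      then show False
        using component_closed[OF wf(2) H(1)] u(1) v(2) H(2) by blast
    qed
    then have "v \<in> C" using CD(2) assms(5) by blast
    \<comment> \<open>Otherwise \<open>v\<close> is in \<open>C - D\<close> while \<open>u\<close>
      is in \<open>D - C\<close>. The definition only excludes arcs from left to right, so the
      reversed arc from \<open>v\<close> to \<open>u\<close> is used.\<close>
    moreover have "v \<in> D"
      using \<open>v \<in> C\<close> u CD(1,3) arcs_ends_symmetric[OF sym_arcs u(2)]
      by (auto simp: separation_def)
    ultimately show "v \<in> C \<inter> D" by blast
  qed
  moreover have "finite (C \<inter> D)"
    using CD(1) finite_verts finite_subset[of "C \<inter> D" "verts G"] by (auto simp: separation_def)
  ultimately have "card (neighbourhood G Z) \<le> sep_order (C, D)"
    by (simp add: sep_order_def card_mono)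
  then show ?thesis using CD(4) by simp
qed

end
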